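(* Let $G$ be a finite, connected, simple undirected graph with vertex set $V$ and edge set $E$, and let $P$ be a $G$-semiorder. Define $$\mathcal{O}_P=\{(u,v): \{u,v\}\in E \text{ and } u<v \text{ in } P\}.$$ Then $\mathcal{O}_P$ is a $G$-semiorientation, and $\mathcal{O}_P$ is the unique $G$-semiorientation compatible with $P$.
   Context: A partial orientation of $G$ is a subset $\mathcal{O}\subseteq V\times V$ such that if $(u,v)\in\mathcal{O}$ then $\{u,v\}\in E$ and $(v,u)\notin\mathcal{O}$; an edge $\{u,v\}$ with $(u,v)\in\mathcal{O}$ is oriented from $u$ to $v$, and an edge with neither $(u,v)$ nor $(v,u)$ in $\mathcal{O}$ is called blank. A cycle $C\subseteq E$ of $G$ is a potential cycle for $\mathcal{O}$ if one can assign directions to the blank edges of $C$ so that $C$ becomes a directed cycle (consistent with the orientations already present). A $G$-semiorientation is a partial orientation $\mathcal{O}$ such that every potential cycle for $\mathcal{O}$ has strictly more blank edges than oriented edges. A semiorder is a poset isomorphic to a poset formed by a finite collection of unit closed intervals $[a,a+1]$ of $\mathbb{R}$, ordered by $[a,a+1]<[b,b+1]$ iff $a+1<b$. A $G$-semiorder is a semiorder structure (poset isomorphic to such an interval order) on the set $V$. A $G$-semiorder $P$ and a $G$-semiorientation $\mathcal{O}$ are compatible if for every edge $\{u,v\}\in E$: $u<v$ in $P$ if and only if $(u,v)\in\mathcal{O}$. *)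

theory Defs
  imports Complex_Main "Graph_Theory.Graph_Theory"
begin

text \<open>
  A finite simple undirected graph is a \<^locale>\<open>pair_graph\<close>: each undirected edge \<open>{u, v}\<close> is
  represented by the two arcs \<open>(u, v)\<close> and \<open>(v, u)\<close>.
  The set \<open>uedges G\<close> recovers the undirected edge set \<open>E\<close>.
\<close>

definition uedge :: "'a \<times> 'a \<Rightarrow> 'a set" where
  "uedge a = {fst a, snd a}"

definition uedges :: "'a pair_pre_digraph \<Rightarrow> 'a set set" where
  "uedges G = uedge ` parcs G"

text \<open>
  The length condition excludes the closed walk \<open>u, v, u\<close> along a single edge, which is a cycle of
  the symmetric digraph but not of the undirected graph.
\<close>

definition is_ucycle :: "'a pair_pre_digraph \<Rightarrow> 'a set set \<Rightarrow> bool" where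
  "is_ucycle G C \<longleftrightarrow>
     (\<exists>p. pre_digraph.cycle (with_proj G) p \<and> 3 \<le> length p \<and> C = uedge ` set p)"

text \<open>The arcs \<open>D\<close> are exactly the arcs of one directed cycle on vertices from \<open>V\<close>.\<close>

definition is_dicycle :: "'a set \<Rightarrow> ('a \<times> 'a) set \<Rightarrow> bool" where
  "is_dicycle V D \<longleftrightarrow>
     (\<exists>p. pre_digraph.cycle (with_proj \<lparr>pverts = V, parcs = D\<rparr>) p \<and> set p = D)"

definition partial_orientation :: "'a pair_pre_digraph \<Rightarrow> ('a \<times> 'a) set \<Rightarrow> bool" where
  "partial_orientation G Or \<longleftrightarrow>
     Or \<subseteq> pverts G \<times> pverts G \<and>
     (\<forall>u v. (u, v) \<in> Or \<longrightarrow> {u, v} \<in> uedges G \<and> (v, u) \<notin> Or)"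

definition blank_edges :: "('a \<times> 'a) set \<Rightarrow> 'a set set \<Rightarrow> 'a set set" where
  "blank_edges Or C = {e \<in> C. \<forall>u v. e = {u, v} \<longrightarrow> (u, v) \<notin> Or \<and> (v, u) \<notin> Or}"

definition oriented_edges :: "('a \<times> 'a) set \<Rightarrow> 'a set set \<Rightarrow> 'a set set" where
  "oriented_edges Or C = {e \<in> C. \<exists>u v. e = {u, v} \<and> (u, v) \<in> Or}"

text \<open>
  The relation \<open>D\<close> gives every edge of \<open>C\<close> exactly one direction, keeping those already
  prescribed by \<open>Or\<close>; only the directions of the blank edges are chosen freely.
\<close>

definition completes_orientation ::
  "('a \<times> 'a) set \<Rightarrow> 'a set set \<Rightarrow> ('a \<times> 'a) set \<Rightarrow> bool" where
  "completes_orientation Or C D \<longleftrightarrow>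
     (\<forall>u v. {u, v} \<in> C \<longleftrightarrow> (u, v) \<in> D \<or> (v, u) \<in> D) \<and>
     (\<forall>u v. (u, v) \<in> D \<longrightarrow> (v, u) \<notin> D) \<and>
     (\<forall>u v. {u, v} \<in> C \<and> (u, v) \<in> Or \<longrightarrow> (u, v) \<in> D)"

definition potential_cycle ::
  "'a pair_pre_digraph \<Rightarrow> ('a \<times> 'a) set \<Rightarrow> 'a set set \<Rightarrow> bool" where
  "potential_cycle G Or C \<longleftrightarrow>
     is_ucycle G C \<and> (\<exists>D. completes_orientation Or C D \<and> is_dicycle (pverts G) D)"

definition semiorientation :: "'a pair_pre_digraph \<Rightarrow> ('a \<times> 'a) set \<Rightarrow> bool" where
  "semiorientation G Or \<longleftrightarrow>
     partial_orientation G Or \<and>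
     (\<forall>C. potential_cycle G Or C \<longrightarrow> card (oriented_edges Or C) < card (blank_edges Or C))"

definition unit_interval :: "real set \<Rightarrow> bool" where
  "unit_interval I \<longleftrightarrow> (\<exists>a. I = {a..a + 1})"

definition interval_less :: "real set \<Rightarrow> real set \<Rightarrow> bool" where
  "interval_less I J \<longleftrightarrow> (\<exists>a b. I = {a..a + 1} \<and> J = {b..b + 1} \<and> a + 1 < b)"

text \<open>
  A semiorder on \<open>V\<close>, given by its strict order relation \<open>P\<close>. The finite collection of intervals is
  a family indexed by a finite set \<open>J\<close>, so an interval may occur several times; \<open>f\<close> is the
  isomorphism. That \<open>V\<close> is finite and that \<open>P\<close> is irreflexive and transitive
  is implied.
\<close>

definition semiorder_on :: "'a set \<Rightarrow> ('a \<times> 'a) set \<Rightarrow> bool" where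
  "semiorder_on V P \<longleftrightarrow>
     P \<subseteq> V \<times> V \<and>
     (\<exists>(J :: nat set) I f.
        finite J \<and> (\<forall>j\<in>J. unit_interval (I j)) \<and> bij_betw f V J \<and>
        (\<forall>u\<in>V. \<forall>v\<in>V. (u, v) \<in> P \<longleftrightarrow> interval_less (I (f u)) (I (f v))))"

definition semiorder_compatible ::
  "'a pair_pre_digraph \<Rightarrow> ('a \<times> 'a) set \<Rightarrow> ('a \<times> 'a) set \<Rightarrow> bool" where
  "semiorder_compatible G P Or \<longleftrightarrow>
     (\<forall>u v. {u, v} \<in> uedges G \<longrightarrow> ((u, v) \<in> P \<longleftrightarrow> (u, v) \<in> Or))"

definition induced_orientation ::
  "'a pair_pre_digraph \<Rightarrow> ('a \<times> 'a) set \<Rightarrow> ('a \<times> 'a) set" where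
  "induced_orientation G P = {(u, v). {u, v} \<in> uedges G \<and> (u, v) \<in> P}"

lemma interval_less_iff: "interval_less {a..a + 1} {b..b + 1} \<longleftrightarrow> a + 1 < b"
  by (auto simp: interval_less_def Icc_eq_Icc)

lemma semiorder_on_strict_order:
  assumes "semiorder_on V P"
  shows "irrefl P" and "trans P"
proof -
  obtain J :: "nat set" and I f where
    P: "P \<subseteq> V \<times> V" and I: "\<forall>j\<in>J. unit_interval (I j)" and f: "bij_betw f V J"
    and less: "\<forall>u\<in>V. \<forall>v\<in>V. (u, v) \<in> P \<longleftrightarrow> interval_less (I (f u)) (I (f v))"
    using assms unfolding semiorder_on_def by blast
  have "\<forall>v\<in>V. \<exists>a. I (f v) = {a..a + 1}"
    using I f unfolding unit_interval_def bij_betw_def by blast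
  then obtain a where "\<forall>v\<in>V. I (f v) = {a v..a v + 1}"
    by metis
  then have "\<forall>u\<in>V. \<forall>v\<in>V. (u, v) \<in> P \<longleftrightarrow> a u + 1 < a v"
    using less by (simp add: interval_less_iff)
  then have *: "(u, v) \<in> P \<longleftrightarrow> u \<in> V \<and> v \<in> V \<and> a u + 1 < a v" for u v
    using P by blast
  show "irrefl P" by (auto simp: irrefl_def *)
  show "trans P" by (auto simp: trans_def *)
qed

end

theory Submission
  imports Defs
begin

text \<open>
  Represent \<open>P\<close> by left endpoints \<open>a\<close>. Along a directed completion of a potential cycle the
  differences of \<open>a\<close> sum to zero; an oriented arc contributes more than \<open>1\<close> and a blank arc at
  least \<open>-1\<close>, so the blank arcs outnumber the oriented ones.
\<close>

text \<open>The map \<open>a\<close> is arbitrary outside \<open>V\<close>, so membership in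
  \<open>V\<close> has to accompany the inequality.\<close>

lemma semiorder_on_obtain_endpoints:
  assumes "semiorder_on V P"
  obtains a :: "'a \<Rightarrow> real"
  where "\<And>u v. (u, v) \<in> P \<longleftrightarrow> u \<in> V \<and> v \<in> V \<and> a u + 1 < a v"
proof -
  obtain J :: "nat set" and I f where
    P: "P \<subseteq> V \<times> V" and I: "\<forall>j\<in>J. unit_interval (I j)" and f: "bij_betw f V J"
    and less: "\<forall>u\<in>V. \<forall>v\<in>V. (u, v) \<in> P \<longleftrightarrow> interval_less (I (f u)) (I (f v))"
    using assms unfolding semiorder_on_def by blast
  have "\<forall>v\<in>V. \<exists>a. I (f v) = {a..a + 1}"
    using I f unfolding unit_interval_def bij_betw_def by blast
  then obtain a where "\<forall>v\<in>V. I (f v) = {a v..a v + 1}"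
    by metis
  then have "\<forall>u\<in>V. \<forall>v\<in>V. (u, v) \<in> P \<longleftrightarrow> a u + 1 < a v"
    using less by (simp add: interval_less_iff)
  with P have "(u, v) \<in> P \<longleftrightarrow> u \<in> V \<and> v \<in> V \<and> a u + 1 < a v" for u v
    by blast
  then show thesis by (rule that)
qed

text \<open>Telescoping: the head of each arc is the tail of the next.\<close>

lemma (in pre_digraph) cas_sum_list_diff:
  fixes f :: "'a \<Rightarrow> 'c :: ab_group_add"
  assumes "cas u p v"
  shows "(\<Sum>e\<leftarrow>p. f (head G e) - f (tail G e)) = f v - f u"
  using assms by (induction u p v rule: cas.induct) auto

text \<open>The visited vertices after the first are the heads of the arcs, so a repeated arc would
  repeat one of them.\<close>

lemma (in pre_digraph) cycle_imp_distinct: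
  assumes "cycle p"
  shows "distinct p"
proof -
  obtain u where "cas u p u" "distinct (tl (awalk_verts u p))" "p \<noteq> []"
    using assms unfolding cycle_def awalk_def by blast
  then show ?thesis
    by (auto simp: awalk_verts_conv' distinct_map)
qed

text \<open>The telescoping sum returns to its start. As no arc occurs twice, it may be taken over
  the set of arcs, which can then be split into oriented and blank ones.\<close>

lemma (in pre_digraph) cycle_sum_diff:
  fixes f :: "'a \<Rightarrow> 'c :: ab_group_add"
  assumes "cycle p"
  shows "(\<Sum>e\<in>set p. f (head G e) - f (tail G e)) = 0"
proof -
  obtain u where "cas u p u"
    using assms unfolding cycle_def awalk_def by blast
  then have "(\<Sum>e\<leftarrow>p. f (head G e) - f (tail G e)) = 0"
    using cas_sum_list_diff by fastforce
  then show ?thesis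
    using cycle_imp_distinct[OF assms] by (simp add: sum_list_distinct_conv_sum_set)
qed

lemma is_dicycle_sum_diff:
  fixes f :: "'a \<Rightarrow> 'c :: ab_group_add"
  assumes "is_dicycle V D"
  shows "finite D" and "D \<noteq> {}" and "(\<Sum>(u, v)\<in>D. f v - f u) = 0"
proof -
  obtain p where p: "pre_digraph.cycle (with_proj \<lparr>pverts = V, parcs = D\<rparr>) p" "set p = D"
    using assms unfolding is_dicycle_def by blast
  show "finite D" using p by auto
  show "D \<noteq> {}" using p by (auto simp: pre_digraph.cycle_def)
  show "(\<Sum>(u, v)\<in>D. f v - f u) = 0"
    using pre_digraph.cycle_sum_diff[OF p(1), of f] p(2) by (simp add: case_prod_unfold)
qed

lemma completes_orientationD:
  assumes "completes_orientation Or C D"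
  shows "{u, v} \<in> C \<longleftrightarrow> (u, v) \<in> D \<or> (v, u) \<in> D"
    and "(u, v) \<in> D \<Longrightarrow> (v, u) \<notin> D"
    and "{u, v} \<in> C \<Longrightarrow> (u, v) \<in> Or \<Longrightarrow> (u, v) \<in> D"
  using assms unfolding completes_orientation_def by blast+

text \<open>Only \<open>(u, v)\<close> and \<open>(v, u)\<close> share an underlying edge, and
  \<open>D\<close> never contains both. Hence edges of \<open>C\<close> can be counted as arcs of
  \<open>D\<close>.\<close>

lemma completes_orientation_inj_on_uedge:
  assumes "completes_orientation Or C D"
  shows "inj_on uedge D"
proof (rule inj_onI)
  fix d e assume "d \<in> D" "e \<in> D" "uedge d = uedge e"
  then show "d = e"
    using completes_orientationD(2)[OF assms, of "fst d" "snd d"]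
    by (cases d; cases e) (auto simp: uedge_def doubleton_eq_iff)
qed

text \<open>A completion keeps each prescribed direction, so no oriented edge of \<open>C\<close> is
  traversed backwards by \<open>D\<close>.\<close>

lemma completes_orientation_oriented_edges:
  assumes "completes_orientation Or C D"
  shows "oriented_edges Or C = uedge ` (D \<inter> Or)"
proof (intro equalityI subsetI)
  fix e assume "e \<in> oriented_edges Or C"
  then obtain u v where uv: "e = {u, v}" "{u, v} \<in> C" "(u, v) \<in> Or"
    by (auto simp: oriented_edges_def)
  then have "(u, v) \<in> D \<inter> Or"
    using completes_orientationD(3)[OF assms] by blast
  then show "e \<in> uedge ` (D \<inter> Or)"
    using uv(1) by (intro image_eqI[of _ _ "(u, v)"]) (simp_all add: uedge_def)
next
  fix e assume "e \<in> uedge ` (D \<inter> Or)"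
  then obtain u v where uv: "e = {u, v}" "(u, v) \<in> D" "(u, v) \<in> Or"
    by (auto simp: uedge_def)
  then show "e \<in> oriented_edges Or C"
    using completes_orientationD(1)[OF assms, of u v] unfolding oriented_edges_def by blast
qed

text \<open>A member of \<open>C\<close> that is not of the form \<open>{u, v}\<close> would count as blank without being an edge of \<open>D\<close>.\<close>

lemma completes_orientation_blank_edges:
  assumes "completes_orientation Or C D" and "C \<subseteq> range uedge"
  shows "blank_edges Or C = uedge ` (D - Or)"
proof -
  note D = completes_orientationD[OF assms(1)]
  show ?thesis
  proof (intro equalityI subsetI)
    fix e assume e: "e \<in> blank_edges Or C"
    then obtain u v where uv: "e = {u, v}"
      using assms(2) by (auto simp: blank_edges_def uedge_def)
    have "e \<in> C" "(u, v) \<notin> Or" "(v, u) \<notin> Or"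
      using e uv by (auto simp: blank_edges_def)
    then have "(u, v) \<in> D - Or \<or> (v, u) \<in> D - Or"
      using D(1)[of u v] uv by blast
    moreover have "e = uedge (u, v)" "e = uedge (v, u)"
      using uv by (auto simp: uedge_def)
    ultimately show "e \<in> uedge ` (D - Or)"
      by blast
  next
    fix e assume "e \<in> uedge ` (D - Or)"
    then obtain u v where uv: "e = {u, v}" "(u, v) \<in> D" "(u, v) \<notin> Or"
      by (auto simp: uedge_def)
    \<comment> \<open>Otherwise the completion would keep \<open>(v, u)\<close>, and
      \<open>D\<close> would contain both directions of the edge.\<close>
    then have "(v, u) \<notin> Or"
      using D(1)[of v u] D(2)[of u v] D(3)[of v u] by blast
    then show "e \<in> blank_edges Or C"
      using uv D(1)[of u v] by (auto simp: blank_edges_def doubleton_eq_iff)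
  qed
qed

text \<open>Antisymmetry holds because \<open>a u + 1 < a v\<close> and \<open>a v + 1 < a u\<close>
  exclude each other.\<close>

lemma partial_orientation_induced_orientation:
  assumes "semiorder_on (pverts G) P"
  shows "partial_orientation G (induced_orientation G P)"
proof -
  obtain a :: "'a \<Rightarrow> real" where
    "\<And>u v. (u, v) \<in> P \<longleftrightarrow> u \<in> pverts G \<and> v \<in> pverts G \<and> a u + 1 < a v"
    using semiorder_on_obtain_endpoints[OF assms] by blast
  then show ?thesis
    unfolding partial_orientation_def induced_orientation_def by auto
qed

lemma semiorientation_induced_orientation:
  assumes "pair_graph G" and "semiorder_on (pverts G) P"
  shows "semiorientation G (induced_orientation G P)"
proof -
  let ?Or = "induced_orientation G P"
  interpret pair_graph G by fact
  obtain a :: "'a \<Rightarrow> real" where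
    a: "\<And>u v. (u, v) \<in> P \<longleftrightarrow> u \<in> pverts G \<and> v \<in> pverts G \<and> a u + 1 < a v"
    using semiorder_on_obtain_endpoints[OF assms(2)] by blast
  have "card (oriented_edges ?Or C) < card (blank_edges ?Or C)"
    if "potential_cycle G ?Or C" for C
  proof -
    obtain D where D: "completes_orientation ?Or C D" "is_dicycle (pverts G) D"
      and C: "is_ucycle G C"
      using \<open>potential_cycle G ?Or C\<close> unfolding potential_cycle_def by blast
    have CG: "C \<subseteq> uedges G"
      using C unfolding is_ucycle_def uedges_def pre_digraph.cycle_def pre_digraph.awalk_def
      by auto
    note fin = is_dicycle_sum_diff(1)[OF D(2)]
    \<comment> \<open>The weight \<open>w\<close> is the shift of the left endpoint along an arc;
      its total over \<open>D\<close> is zero.\<close>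
    define w where "w = (\<lambda>(u, v). a v - a u)"
    have oriented: "1 < w d" if "d \<in> D \<inter> ?Or" for d
      using that a by (auto simp: w_def induced_orientation_def)
    have blank: "- 1 \<le> w d" if "d \<in> D - ?Or" for d
    proof (cases d)
      case (Pair u v)
      then have uv: "(u, v) \<in> D" "(v, u) \<notin> D" "{u, v} \<in> C"
        using that completes_orientationD(1,2)[OF D(1), of u v] by auto
      \<comment> \<open>If \<open>v\<close> were below \<open>u\<close> in \<open>P\<close>, the
        edge would already be directed from \<open>v\<close> to \<open>u\<close>, and
        \<open>D\<close> would have to contain \<open>(v, u)\<close>. So
        \<open>a v + 1 < a u\<close> fails, which is the claimed bound.\<close>
      then have "{v, u} \<in> C" "{v, u} \<in> uedges G"
        using CG by (auto simp: insert_commute)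
      then have "(v, u) \<notin> P"
        using uv(2) completes_orientationD(3)[OF D(1), of v u]
        unfolding induced_orientation_def by blast
      moreover have "u \<in> pverts G" "v \<in> pverts G"
        using \<open>{v, u} \<in> uedges G\<close>
        by (auto simp: uedges_def uedge_def doubleton_eq_iff dest: in_arcsD1 in_arcsD2)
      ultimately show ?thesis
        using a[of v u] Pair by (simp add: w_def)
    qed
    have sum: "sum w (D \<inter> ?Or) + sum w (D - ?Or) = 0"
      using is_dicycle_sum_diff(3)[OF D(2), of a] sum.Int_Diff[OF fin, of w ?Or]
      by (simp add: w_def)
    have lb: "- real (card (D - ?Or)) \<le> sum w (D - ?Or)"
      using sum_mono[of "D - ?Or" "\<lambda>_. - 1" w] blank by simp
    have "card (D \<inter> ?Or) < card (D - ?Or)"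
    \<comment> \<open>The strict bound on the oriented sum requires at least one oriented arc.
      Without any, all arcs of \<open>D\<close> are blank, and a cycle has at least one arc.\<close>
    proof (cases "D \<inter> ?Or = {}")
      case True
      then show ?thesis
        using fin is_dicycle_sum_diff(2)[OF D(2)] by (simp add: card_gt_0_iff Diff_triv)
    next
      case False
      then have "real (card (D \<inter> ?Or)) < sum w (D \<inter> ?Or)"
        using sum_strict_mono[of "D \<inter> ?Or" "\<lambda>_. 1" w] oriented fin by simp
      then show ?thesis
        using sum lb by linarith
    qed
    moreover have "card (oriented_edges ?Or C) = card (D \<inter> ?Or)"
      unfolding completes_orientation_oriented_edges[OF D(1)]
      by (intro card_image inj_on_subset[OF completes_orientation_inj_on_uedge[OF D(1)]]) auto
    moreover have "card (blank_edges ?Or C) = card (D - ?Or)"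
    proof -
      have "C \<subseteq> range uedge" using CG by (auto simp: uedges_def)
      then show ?thesis
        unfolding completes_orientation_blank_edges[OF D(1) \<open>C \<subseteq> range uedge\<close>]
        by (intro card_image inj_on_subset[OF completes_orientation_inj_on_uedge[OF D(1)]]) auto
    qed
    ultimately show ?thesis by simp
  qed
  then show ?thesis
    using partial_orientation_induced_orientation[OF assms(2)]
    unfolding semiorientation_def by blast
qed

lemma semiorder_compatible_induced_orientation:
  "semiorder_compatible G P (induced_orientation G P)"
  by (simp add: semiorder_compatible_def induced_orientation_def)

text \<open>All pairs in a partial orientation lie over edges of \<open>G\<close>, and over edges
  compatibility lets \<open>P\<close> decide membership.\<close>

lemma partial_orientation_compatible_unique:
  assumes "partial_orientation G Or" and "semiorder_compatible G P Or"
  shows "Or = induced_orientation G P"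
  using assms
  unfolding partial_orientation_def semiorder_compatible_def induced_orientation_def
  by fast

theorem theorem3p2:
  fixes G :: "'a pair_pre_digraph" and P :: "('a \<times> 'a) set"
  assumes "pair_graph G"
    and "Digraph_Component.connected (with_proj G)"
    and "semiorder_on (pverts G) P"
  shows "semiorientation G (induced_orientation G P) \<and>
    semiorder_compatible G P (induced_orientation G P) \<and>
    (\<forall>Or. semiorientation G Or \<and> semiorder_compatible G P Or \<longrightarrow> Or = induced_orientation G P)"
  using semiorientation_induced_orientation[OF assms(1,3)]
    semiorder_compatible_induced_orientation partial_orientation_compatible_unique
  unfolding semiorientation_def by blast

end
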